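(* Let $\mathcal{H}$, $|r\rangle$, $|\widetilde w\rangle$, $\mathcal{V}$ and $U=-I_sI_L$ be as defined in the context. With respect to the orthonormal basis $\{|\widetilde w\rangle,|r\rangle\}$ in the invariant subspace $\mathcal{V}$ of $U$, the operator $U$ admits the real unitary matrix representation $$U=\begin{bmatrix}\frac{N-2\ell}{N} & \frac{2\sqrt{\ell(N-\ell)}}{N}\\[2pt] \frac{-2\sqrt{\ell(N-\ell)}}{N} & \frac{N-2\ell}{N}\end{bmatrix}=\begin{bmatrix}\cos\theta&\sin\theta\\ -\sin\theta&\cos\theta\end{bmatrix},\qquad \theta\equiv\sin^{-1}\left(\frac{2\sqrt{\ell(N-\ell)}}{N}\right).$$
   Context: Let $\mathcal{H}$ be the Hilbert space generated by the orthonormal basis $\{|w_1\rangle,\ldots,|w_N\rangle\}$, corresponding to a database of $N$ items $w_1,\ldots,w_N$, of which the first $\ell$ are the desired objects of a search: an oracle function $f$ satisfies $f(w_j)=1$ for $1\le j\le\ell$ and $f(w_j)=0$ for $\ell<j\le N$. Define the linear operator $I_L$ on $\mathcal{H}$ by $I_L|w_j\rangle=(-1)^{f(w_j)}|w_j\rangle$ for $j=1,\ldots,N$, i.e. $I_L=I-2\sum_{j=1}^{\ell}|w_j\rangle\langle w_j|$, where $I$ is the identity. Define $|s\rangle=\frac{1}{\sqrt N}\sum_{i=1}^N|w_i\rangle$, $|r\rangle=\frac{1}{\sqrt{1-(\ell/N)}}\left(|s\rangle-\frac{1}{\sqrt N}\sum_{i=1}^{\ell}|w_i\rangle\right)$,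 $I_s=I-2|s\rangle\langle s|$, $U=-I_sI_L$, and $|\widetilde w\rangle=\frac{1}{\sqrt{\ell}}\sum_{i=1}^{\ell}|w_i\rangle$. Let $\mathcal{V}=\left\{a\sum_{i=1}^{\ell}|w_i\rangle+b|r\rangle : a,b\in\mathbb{C}\right\}$, a two-dimensional subspace of $\mathcal{H}$ invariant under $U$, with orthonormal basis $\{|\widetilde w\rangle,|r\rangle\}$. The matrix of $U$ in the ordered basis $(e_1,e_2)=(|\widetilde w\rangle,|r\rangle)$ has $(i,j)$ entry $\langle e_i|U|e_j\rangle$.
   Formalization: The angle θ is the principal arcsine only when 2ℓ ≤ N; for 2ℓ > N it is π minus the principal arcsine, since otherwise cos θ = (N−2ℓ)/N fails in sign (e.g. N=4, ℓ=3); 1 ≤ ℓ < N is assumed so that the basis vectors are defined. *)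

theory Defs
  imports "HOL-Analysis.Analysis"
begin

text \<open>
  The inner product follows the Dirac convention: conjugate-linear in the first argument and
  linear in the second. Only finite-dimensional spaces occur below, so completeness is automatic.
\<close>

locale complex_inner_space = vector_space scale
  for scale :: "complex \<Rightarrow> 'a::ab_group_add \<Rightarrow> 'a" (infixr "*\<^sub>C" 75) +
  fixes braket :: "'a \<Rightarrow> 'a \<Rightarrow> complex" ("\<langle>_|_\<rangle>")
  assumes braket_add_right: "\<langle>x|y + z\<rangle> = \<langle>x|y\<rangle> + \<langle>x|z\<rangle>"
    and braket_scale_right: "\<langle>x|c *\<^sub>C y\<rangle> = c * \<langle>x|y\<rangle>"
    and braket_commute: "\<langle>x|y\<rangle> = cnj \<langle>y|x\<rangle>"
    and braket_pos: "x \<noteq> 0 \<Longrightarrow> 0 < Re \<langle>x|x\<rangle>"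
begin

definition orthonormal_basis :: "('i \<Rightarrow> 'a) \<Rightarrow> 'i set \<Rightarrow> 'a set \<Rightarrow> bool" where
  "orthonormal_basis e J W \<longleftrightarrow>
     (\<forall>i\<in>J. \<forall>j\<in>J. \<langle>e i|e j\<rangle> = (if i = j then 1 else 0)) \<and> span (e ` J) = W"

definition matrix_of :: "('n::finite \<Rightarrow> 'a) \<Rightarrow> ('a \<Rightarrow> 'a) \<Rightarrow> complex^'n^'n" where
  "matrix_of e T = (\<chi> i j. \<langle>e i|T (e j)\<rangle>)"

end

definition unitary_matrix :: "complex^'n^'n \<Rightarrow> bool" where
  "unitary_matrix A \<longleftrightarrow>
     map_matrix cnj (transpose A) ** A = mat 1 \<and> A ** map_matrix cnj (transpose A) = mat 1"

text \<open>
  The Hilbert space is the whole type \<^typ>\<open>'a\<close>; the index \<open>j\<close> stands for the item \<open>w\<^sub>j\<close>, and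
  the objects searched for are those with index in \<open>{1..l}\<close>.
\<close>

locale search_space = complex_inner_space scale braket
  for scale :: "complex \<Rightarrow> 'a::ab_group_add \<Rightarrow> 'a" (infixr "*\<^sub>C" 75)
    and braket :: "'a \<Rightarrow> 'a \<Rightarrow> complex" ("\<langle>_|_\<rangle>") +
  fixes w :: "nat \<Rightarrow> 'a" and N l :: nat
  assumes w_basis: "orthonormal_basis w {1..N} UNIV"
    and l_pos: "1 \<le> l" and l_less: "l < N"
begin

definition f :: "nat \<Rightarrow> nat" where
  "f j = (if j \<in> {1..l} then 1 else 0)"

definition I_L :: "'a \<Rightarrow> 'a" where
  "I_L x = x - 2 *\<^sub>C (\<Sum>j=1..l. \<langle>w j|x\<rangle> *\<^sub>C w j)"

lemma I_L_basis:
  assumes "j \<in> {1..N}"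
  shows "I_L (w j) = (-1) ^ f j *\<^sub>C w j"
proof -
  have "\<langle>w i|w j\<rangle> = (if i = j then 1 else 0)" if "i \<in> {1..l}" for i
    using w_basis l_less that assms unfolding orthonormal_basis_def by auto
  then have "(\<Sum>i=1..l. \<langle>w i|w j\<rangle> *\<^sub>C w i) = (\<Sum>i=1..l. if i = j then w j else 0)"
    by (intro sum.cong) auto
  also have "\<dots> = of_nat (f j) *\<^sub>C w j"
    by (simp add: f_def)
  finally have "I_L (w j) = (1 - 2 * of_nat (f j)) *\<^sub>C w j"
    by (simp add: I_L_def scale_left_diff_distrib)
  then show ?thesis
    by (simp add: f_def)
qed

definition s :: 'a where
  "s = complex_of_real (1 / sqrt (real N)) *\<^sub>C (\<Sum>i=1..N. w i)"

definition r :: 'a where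
  "r = complex_of_real (1 / sqrt (1 - real l / real N)) *\<^sub>C
         (s - complex_of_real (1 / sqrt (real N)) *\<^sub>C (\<Sum>i=1..l. w i))"

definition w_tilde :: 'a where
  "w_tilde = complex_of_real (1 / sqrt (real l)) *\<^sub>C (\<Sum>i=1..l. w i)"

definition I_s :: "'a \<Rightarrow> 'a" where
  "I_s x = x - 2 *\<^sub>C (\<langle>s|x\<rangle> *\<^sub>C s)"

definition U :: "'a \<Rightarrow> 'a" where
  "U x = - I_s (I_L x)"

definition V :: "'a set" where
  "V = {a *\<^sub>C (\<Sum>i=1..l. w i) + b *\<^sub>C r |a b. True}"

text \<open>The ordered pair \<open>(w_tilde, r)\<close>, indexed by the type \<^typ>\<open>2\<close> with elements 1 and 2.\<close>

definition basis_V :: "2 \<Rightarrow> 'a" where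
  "basis_V i = (if i = 1 then w_tilde else r)"

end

end

theory Submission
  imports Defs
begin

text \<open>
  Put \<open>\<alpha> = \<surd>(l/N)\<close> and \<open>\<beta> = \<surd>((N - l)/N)\<close>. Since \<open>r\<close> is the normalised sum of the undesired
  basis vectors, \<open>s = \<alpha> w_tilde + \<beta> r\<close>, while \<open>I_L\<close> negates \<open>w_tilde\<close> and fixes \<open>r\<close>. Hence \<open>U\<close>
  maps \<open>w_tilde\<close> to \<open>w_tilde - 2\<alpha> s\<close> and \<open>r\<close> to \<open>2\<beta> s - r\<close>, and the matrix entries are
  \<open>c = 1 - 2\<alpha>\<^sup>2 = 2\<beta>\<^sup>2 - 1\<close> and \<open>\<plusminus>d = \<plusminus>2\<alpha>\<beta>\<close>, where \<open>c\<^sup>2 + d\<^sup>2 = (\<alpha>\<^sup>2 + \<beta>\<^sup>2)\<^sup>2 = 1\<close>.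
\<close>

section \<open>Sesquilinearity of the bracket and spans of two vectors\<close>

context complex_inner_space
begin

lemma braket_add_left: "\<langle>x + y|z\<rangle> = \<langle>x|z\<rangle> + \<langle>y|z\<rangle>"
  by (metis braket_add_right braket_commute complex_cnj_add)

lemma braket_scale_left: "\<langle>c *\<^sub>C x|y\<rangle> = cnj c * \<langle>x|y\<rangle>"
  by (metis braket_scale_right braket_commute complex_cnj_mult)

lemma braket_zero_right: "\<langle>x|0\<rangle> = 0"
  using braket_add_right [of x 0 0] by simp

lemma braket_sum_right: "\<langle>x|\<Sum>i\<in>A. g i\<rangle> = (\<Sum>i\<in>A. \<langle>x|g i\<rangle>)"
  by (induction A rule: infinite_finite_induct) (simp_all add: braket_zero_right braket_add_right)

lemma braket_sum_left: "\<langle>\<Sum>i\<in>A. g i|x\<rangle> = (\<Sum>i\<in>A. \<langle>g i|x\<rangle>)"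
  by (subst (1 2) braket_commute) (simp add: braket_sum_right)

lemma span_pair: "span {x, y} = {a *\<^sub>C x + b *\<^sub>C y |a b. True}"
proof -
  have "z \<in> span {x, y} \<longleftrightarrow> (\<exists>a b. z = a *\<^sub>C x + b *\<^sub>C y)" for z
    by (simp add: span_breakdown_eq diff_eq_eq add.commute)
  then show ?thesis
    by auto
qed

end

section \<open>Sums of basis vectors, and the operators acting on them\<close>

context search_space
begin

text \<open>Up to scalars, \<open>s\<close>, \<open>w_tilde\<close> and \<open>r\<close> are the
  blocks over \<open>{1..N}\<close>, \<open>{1..l}\<close> and \<open>{l<..N}\<close>, so their
  inner products reduce to counting common indices.\<close>

abbreviation block :: "nat set \<Rightarrow> 'a" where
  "block A \<equiv> \<Sum>i\<in>A. w i"

lemma braket_w: "i \<in> {1..N} \<Longrightarrow> j \<in> {1..N} \<Longrightarrow> \<langle>w i|w j\<rangle> = (if i = j then 1 else 0)"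
  using w_basis unfolding orthonormal_basis_def by auto

lemma braket_w_block:
  assumes "i \<in> {1..N}" "A \<subseteq> {1..N}"
  shows "\<langle>w i|block A\<rangle> = (if i \<in> A then 1 else 0)"
proof -
  have "\<langle>w i|block A\<rangle> = (\<Sum>j\<in>A. if i = j then 1 else 0)"
    unfolding braket_sum_right using assms by (intro sum.cong braket_w) auto
  also have "\<dots> = (if i \<in> A then 1 else 0)"
    using finite_subset [OF assms(2)] by simp
  finally show ?thesis .
qed

lemma braket_block:
  assumes "A \<subseteq> {1..N}" "B \<subseteq> {1..N}"
  shows "\<langle>block A|block B\<rangle> = of_nat (card (A \<inter> B))"
proof -
  have "\<langle>block A|block B\<rangle> = (\<Sum>i\<in>A. if i \<in> B then 1 else 0)"
    unfolding braket_sum_left using assms by (intro sum.cong braket_w_block) auto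
  also have "\<dots> = of_nat (card (A \<inter> B))"
    using finite_subset [OF assms(1)] by (simp flip: sum.inter_restrict)
  finally show ?thesis .
qed

lemma I_L_block:
  assumes "A \<subseteq> {1..N}"
  shows "I_L (block A) = block A - 2 *\<^sub>C block ({1..l} \<inter> A)"
proof -
  have "(\<Sum>j=1..l. \<langle>w j|block A\<rangle> *\<^sub>C w j) = (\<Sum>j=1..l. if j \<in> A then w j else 0)"
    using l_less assms by (intro sum.cong) (auto simp: braket_w_block)
  then show ?thesis
    by (simp add: I_L_def sum.inter_restrict)
qed

lemma I_L_scale: "I_L (c *\<^sub>C x) = c *\<^sub>C I_L x"
  by (simp add: I_L_def braket_scale_right scale_right_diff_distrib scale_sum_right
      mult.left_commute)

lemma I_L_add: "I_L (x + y) = I_L x + I_L y"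
  by (simp add: I_L_def braket_add_right scale_left_distrib scale_right_distrib sum.distrib)

text \<open>Here \<open>- I_s\<close> is 2|s><s| - I, the reflection that fixes \<open>s\<close> and
  negates its orthogonal complement (inversion about the mean).\<close>

lemma U_eq: "U x = (2 * \<langle>s|I_L x\<rangle>) *\<^sub>C s - I_L x"
  by (simp add: U_def I_s_def)

lemma U_scale: "U (c *\<^sub>C x) = c *\<^sub>C U x"
  by (simp add: U_eq I_L_scale braket_scale_right scale_right_diff_distrib mult.left_commute)

lemma U_add: "U (x + y) = U x + U y"
  by (simp add: U_eq I_L_add braket_add_right distrib_left scale_left_distrib)

lemma block_split: "block {1..N} = block {1..l} + block {l<..N}"
proof -
  have "{1..N} = {1..l} \<union> {l<..N}"
    using l_less by auto
  then show ?thesis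
    by (simp add: sum.union_disjoint ivl_disj_int)
qed

text \<open>Subtracting the desired part of \<open>s\<close> leaves the undesired block with weight
  1/sqrt N; the two factors merge because (1 - l/N) N = N - l.\<close>

lemma r_eq: "r = complex_of_real (1 / sqrt (real N - real l)) *\<^sub>C block {l<..N}"
proof -
  have "1 / sqrt (1 - real l / real N) * (1 / sqrt (real N)) = 1 / sqrt (real N - real l)"
    using l_less by (simp add: field_simps flip: real_sqrt_mult)
  moreover have "r = complex_of_real (1 / sqrt (1 - real l / real N) * (1 / sqrt (real N)))
      *\<^sub>C block {l<..N}"
    unfolding r_def s_def block_split by (simp add: scale_right_distrib)
  ultimately show ?thesis
    by simp
qed

lemma s_eq: "s = complex_of_real (sqrt (real l / real N)) *\<^sub>C w_tilde
    + complex_of_real (sqrt ((real N - real l) / real N)) *\<^sub>C r"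
proof -
  \<comment> \<open>Each amplitude times the normalising factor of its block gives the uniform
    coefficient of \<open>s\<close>.\<close>
  have "sqrt (real l / real N) * (1 / sqrt (real l)) = 1 / sqrt (real N)"
    "sqrt ((real N - real l) / real N) * (1 / sqrt (real N - real l)) = 1 / sqrt (real N)"
    using l_pos l_less by (simp_all add: real_sqrt_divide)
  then show ?thesis
    by (simp only: s_def w_tilde_def r_eq block_split scale_right_distrib scale_scale
        flip: of_real_mult)
qed

section \<open>Orthonormality of \<open>w_tilde\<close> and \<open>r\<close>, and their images under
  \<open>I_L\<close>\<close>

lemma braket_w_tilde: "\<langle>w_tilde|w_tilde\<rangle> = 1"
proof -
  let ?q = "1 / sqrt (real l)"
  have "\<langle>block {1..l}|block {1..l}\<rangle> = complex_of_real (real l)"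
    using l_less by (subst braket_block) auto
  then have "\<langle>w_tilde|w_tilde\<rangle> = complex_of_real (?q * ?q * real l)"
    by (simp only: w_tilde_def braket_scale_left braket_scale_right complex_cnj_complex_of_real
        of_real_mult mult.assoc)
  also have "?q * ?q * real l = 1"
    using l_pos by simp
  finally show ?thesis
    by simp
qed

lemma braket_r: "\<langle>r|r\<rangle> = 1"
proof -
  let ?q = "1 / sqrt (real N - real l)"
  have "\<langle>block {l<..N}|block {l<..N}\<rangle> = complex_of_real (real N - real l)"
    using l_less by (subst braket_block) (auto simp: of_nat_diff)
  then have "\<langle>r|r\<rangle> = complex_of_real (?q * ?q * (real N - real l))"
    by (simp only: r_eq braket_scale_left braket_scale_right complex_cnj_complex_of_real
        of_real_mult mult.assoc)
  also have "?q * ?q * (real N - real l) = 1"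
    using l_less by simp
  finally show ?thesis
    by simp
qed

lemma braket_w_tilde_r: "\<langle>w_tilde|r\<rangle> = 0"
proof -
  have "{1..l} \<inter> {l<..N} = {}"
    by auto
  moreover have "{1..l} \<subseteq> {1..N}" "{l<..N} \<subseteq> {1..N}"
    using l_less by auto
  ultimately have "\<langle>block {1..l}|block {l<..N}\<rangle> = 0"
    by (simp only: braket_block card.empty of_nat_0)
  then show ?thesis
    by (simp add: w_tilde_def r_eq braket_scale_left braket_scale_right)
qed

lemma braket_r_w_tilde: "\<langle>r|w_tilde\<rangle> = 0"
  using braket_w_tilde_r braket_commute [of r w_tilde] by simp

lemmas braket_basis = braket_w_tilde braket_r braket_w_tilde_r braket_r_w_tilde

lemma I_L_w_tilde: "I_L w_tilde = - w_tilde"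
proof -
  have "I_L (block {1..l}) = block {1..l} - 2 *\<^sub>C block {1..l}"
    using l_less by (subst I_L_block) auto
  also have "\<dots> = - block {1..l}"
    \<comment> \<open>This instance turns the scalar multiple by 2 into a sum of two copies, one of
      which cancels.\<close>
    using scale_left_distrib [of 1 1 "block {1..l}"] by simp
  finally show ?thesis
    by (simp add: w_tilde_def I_L_scale)
qed

lemma I_L_r: "I_L r = r"
proof -
  have "{1..l} \<inter> {l<..N} = {}"
    by auto
  moreover have "{l<..N} \<subseteq> {1..N}"
    by auto
  ultimately have "I_L (block {l<..N}) = block {l<..N}"
    by (simp add: I_L_block)
  then show ?thesis
    by (simp add: r_eq I_L_scale)
qed

section \<open>The cosine \<open>c\<close> and sine \<open>d\<close> of the rotation, and the
  columns of the matrix of \<open>U\<close>\<close>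

definition c :: real where
  "c = (real N - 2 * real l) / real N"

definition d :: real where
  "d = 2 * sqrt (real l * (real N - real l)) / real N"

lemma two_amplitudes: "2 * sqrt (real l / real N) * sqrt ((real N - real l) / real N) = d"
  by (simp add: d_def real_sqrt_divide real_sqrt_mult)

lemma c_squared_add_d_squared: "c\<^sup>2 + d\<^sup>2 = 1"
proof -
  have "(sqrt (real l * (real N - real l)))\<^sup>2 = real l * (real N - real l)"
    using l_less by simp
  then have "c\<^sup>2 + d\<^sup>2 = ((real N - 2 * real l)\<^sup>2 + 4 * (real l * (real N - real l))) / (real N)\<^sup>2"
    by (simp add: c_def d_def power_divide power_mult_distrib add_divide_distrib)
  \<comment> \<open>Over the common denominator, the claim becomes this polynomial identity.\<close>
  also have "(real N - 2 * real l)\<^sup>2 + 4 * (real l * (real N - real l)) = (real N)\<^sup>2"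
    by (simp add: power2_eq_square algebra_simps)
  finally show ?thesis
    using l_less by simp
qed

text \<open>Translates the sign of the cosine, which selects the branch of the arcsine, into a
  condition on the item counts.\<close>

lemma c_nonneg_iff: "0 \<le> c \<longleftrightarrow> 2 * l \<le> N"
  using l_less by (simp add: c_def zero_le_divide_iff) linarith

lemma U_w_tilde: "U w_tilde = complex_of_real c *\<^sub>C w_tilde - complex_of_real d *\<^sub>C r"
proof -
  define \<alpha> \<beta> where "\<alpha> = sqrt (real l / real N)" and "\<beta> = sqrt ((real N - real l) / real N)"
  have s: "s = complex_of_real \<alpha> *\<^sub>C w_tilde + complex_of_real \<beta> *\<^sub>C r"
    by (simp only: s_eq \<alpha>_def \<beta>_def)
  have \<alpha>: "1 - 2 * \<alpha> * \<alpha> = c"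
    using l_less by (simp add: \<alpha>_def c_def diff_divide_distrib mult.assoc)
  have d: "d = 2 * \<alpha> * \<beta>"
    by (simp only: two_amplitudes \<alpha>_def \<beta>_def)
  have "\<langle>s|I_L w_tilde\<rangle> = - complex_of_real \<alpha>"
    \<comment> \<open>Scaling by -1 moves the minus sign of \<open>I_L w_tilde\<close> out of the
      bracket.\<close>
    using braket_scale_right [of s "-1" w_tilde]
    by (simp add: I_L_w_tilde s braket_add_left braket_scale_left braket_basis)
  then have "U w_tilde = w_tilde - complex_of_real (2 * \<alpha>) *\<^sub>C s"
    by (simp add: U_eq I_L_w_tilde)
  also have "\<dots> = complex_of_real (1 - 2 * \<alpha> * \<alpha>) *\<^sub>C w_tilde - complex_of_real (2 * \<alpha> * \<beta>) *\<^sub>C r"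
    by (simp add: s scale_right_distrib scale_left_diff_distrib)
  finally show ?thesis
    by (simp only: \<alpha> d)
qed

lemma U_r: "U r = complex_of_real d *\<^sub>C w_tilde + complex_of_real c *\<^sub>C r"
proof -
  define \<alpha> \<beta> where "\<alpha> = sqrt (real l / real N)" and "\<beta> = sqrt ((real N - real l) / real N)"
  have s: "s = complex_of_real \<alpha> *\<^sub>C w_tilde + complex_of_real \<beta> *\<^sub>C r"
    by (simp only: s_eq \<alpha>_def \<beta>_def)
  have \<beta>: "2 * \<beta> * \<beta> - 1 = c"
    using l_less by (simp add: \<beta>_def c_def field_simps)
  have d: "d = 2 * \<beta> * \<alpha>"
    by (simp only: \<alpha>_def \<beta>_def ac_simps flip: two_amplitudes)
  have "\<langle>s|I_L r\<rangle> = complex_of_real \<beta>"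
    by (simp add: I_L_r s braket_add_left braket_scale_left braket_basis)
  then have "U r = complex_of_real (2 * \<beta>) *\<^sub>C s - r"
    by (simp add: U_eq I_L_r)
  also have "\<dots> = complex_of_real (2 * \<beta> * \<alpha>) *\<^sub>C w_tilde + complex_of_real (2 * \<beta> * \<beta> - 1) *\<^sub>C r"
    by (simp add: s scale_right_distrib scale_left_diff_distrib)
  finally show ?thesis
    by (simp only: \<beta> d)
qed

text \<open>The two descriptions differ by the nonzero factor sqrt l on the first vector, which the
  free coefficient absorbs in either direction.\<close>

lemma V_eq: "V = {a *\<^sub>C w_tilde + b *\<^sub>C r |a b. True}"
proof -
  have block: "block {1..l} = complex_of_real (sqrt (real l)) *\<^sub>C w_tilde"
    using l_pos by (simp add: w_tilde_def)
  have "\<exists>a'. a *\<^sub>C block {1..l} = a' *\<^sub>C w_tilde" for a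
    unfolding block by auto
  moreover have "\<exists>a'. a *\<^sub>C w_tilde = a' *\<^sub>C block {1..l}" for a
    by (auto simp: w_tilde_def)
  ultimately show ?thesis
    unfolding V_def by (auto; metis)
qed

lemma orthonormal_basis_V: "orthonormal_basis basis_V UNIV V"
proof -
  have "range basis_V = {w_tilde, r}"
    by (auto simp: UNIV_2 basis_V_def)
  then have "span (range basis_V) = V"
    by (simp only: V_eq span_pair)
  then show ?thesis
    by (simp add: orthonormal_basis_def forall_2 basis_V_def braket_basis)
qed

lemma U_invariant: "U ` V \<subseteq> V"
proof -
  have "U (a *\<^sub>C w_tilde + b *\<^sub>C r) = (a * complex_of_real c + b * complex_of_real d) *\<^sub>C w_tilde
      + (b * complex_of_real c - a * complex_of_real d) *\<^sub>C r" for a b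
    by (simp add: U_add U_scale U_w_tilde U_r scale_right_distrib scale_right_diff_distrib
        scale_left_distrib scale_left_diff_distrib)
  then show ?thesis
    unfolding V_eq by blast
qed

lemma matrix_of_U:
  "matrix_of basis_V U = map_matrix complex_of_real (vector [vector [c, d], vector [- d, c]])"
proof -
  \<comment> \<open>Written as a sum, the image is open to additivity of the bracket; the deleted
    simp rules would pull the sign out again.\<close>
  have U_w_tilde': "U w_tilde = complex_of_real c *\<^sub>C w_tilde + complex_of_real (- d) *\<^sub>C r"
    by (simp add: U_w_tilde)
  show ?thesis
    by (simp add: vec_eq_iff forall_2 matrix_of_def map_matrix_def basis_V_def U_w_tilde' U_r
        braket_add_right braket_scale_right braket_basis del: of_real_minus scale_minus_left)
qed

end

section \<open>Rotation matrices and the choice of the angle\<close>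

lemma unitary_matrix_rotation:
  fixes c d :: real
  assumes "c\<^sup>2 + d\<^sup>2 = 1"
  shows "unitary_matrix (map_matrix complex_of_real
    (vector [vector [c, d], vector [- d, c]] :: real^2^2))"
proof -
  have "complex_of_real c * complex_of_real c + complex_of_real d * complex_of_real d = 1"
    using assms by (simp add: power2_eq_square flip: of_real_mult of_real_add)
  then show ?thesis
    by (simp add: unitary_matrix_def vec_eq_iff forall_2 map_matrix_def transpose_def
        matrix_matrix_mult_def mat_def sum_2 add.commute)
qed

text \<open>The cosine is nonnegative on the range of \<open>arcsin\<close>, so
  \<open>arcsin d\<close> has cosine |c|. For negative \<open>c\<close>, passing to
  \<open>pi - arcsin d\<close> flips the sign of the cosine and keeps the sine.\<close>

lemma cos_sin_arcsin_branch:
  fixes c d :: real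
  assumes "c\<^sup>2 + d\<^sup>2 = 1"
  defines "\<theta> \<equiv> if 0 \<le> c then arcsin d else pi - arcsin d"
  shows "cos \<theta> = c" "sin \<theta> = d"
proof -
  have "\<bar>d\<bar> \<le> 1"
    using assms(1) zero_le_power2 [of c] unfolding abs_square_le_1 [symmetric] by linarith
  then have d: "-1 \<le> d" "d \<le> 1"
    by auto
  have "cos (arcsin d) = sqrt (1 - d\<^sup>2)"
    using d by (rule cos_arcsin)
  also have "1 - d\<^sup>2 = c\<^sup>2"
    using assms(1) by simp
  finally have "cos (arcsin d) = \<bar>c\<bar>"
    by simp
  then show "cos \<theta> = c" "sin \<theta> = d"
    using d by (auto simp: \<theta>_def)
qed

theorem theorem3p4:
  fixes scale :: "complex \<Rightarrow> 'a::ab_group_add \<Rightarrow> 'a"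
    and braket :: "'a \<Rightarrow> 'a \<Rightarrow> complex"
    and w :: "nat \<Rightarrow> 'a" and N l :: nat
  assumes "search_space scale braket w N l"
  shows
    "let U = search_space.U scale braket w N l;
         V = search_space.V scale w N l;
         e = search_space.basis_V scale w N l;
         c = (real N - 2 * real l) / real N;
         d = 2 * sqrt (real l * (real N - real l)) / real N;
         \<theta> = (if 2 * l \<le> N then arcsin d else pi - arcsin d);
         A = vector [vector [c, d], vector [- d, c]] :: real^2^2;
         R = vector [vector [cos \<theta>, sin \<theta>], vector [- sin \<theta>, cos \<theta>]] :: real^2^2
     in complex_inner_space.orthonormal_basis scale braket e UNIV V \<and>
        U ` V \<subseteq> V \<and>
        complex_inner_space.matrix_of braket e U = map_matrix complex_of_real A \<and>
        unitary_matrix (map_matrix complex_of_real A) \<and>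
        sin \<theta> = d \<and>
        A = R"
proof -
  interpret search_space scale braket w N l
    by (fact assms)
  \<comment> \<open>When more than half of the items are desired, \<open>c\<close> is negative and
    the principal arcsine would give cosine \<open>- c\<close>; hence the second branch.\<close>
  have "cos (if 2 * l \<le> N then arcsin d else pi - arcsin d) = c"
    "sin (if 2 * l \<le> N then arcsin d else pi - arcsin d) = d"
    using cos_sin_arcsin_branch [OF c_squared_add_d_squared] unfolding c_nonneg_iff by auto
  then show ?thesis
    unfolding Let_def c_def [symmetric] d_def [symmetric]
    using orthonormal_basis_V U_invariant matrix_of_U
      unitary_matrix_rotation [OF c_squared_add_d_squared]
    by (simp only: simp_thms)
qed

end
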